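(* Let $c=a+ib$ with $a,b\in\mathbb R$, and let $L=\partial_t-c\,\partial_x$ on $\mathbb T^2$. Let $k_1,k_2\in\mathbb R$, and suppose that $u\in\mathcal D'(\mathbb T^2)$ is a distributional solution of $Lu=f$ with $f\in H_{\mathrm{mix}}^{(k_1,k_2)}(\mathbb T^2)$. Then the following hold. (i) If $b\neq 0$, then for every $\theta\in[0,1]$, $u\in H_{\mathrm{mix}}^{(k_1+\theta,\,k_2+1-\theta)}(\mathbb T^2)$. Moreover, $$\|u-\widehat u(0,0)\|_{H_{\mathrm{mix}}^{(k_1+\theta,\,k_2+1-\theta)}(\mathbb T^2)}\le C\,\|f\|_{H_{\mathrm{mix}}^{(k_1,k_2)}(\mathbb T^2)},$$ where $C>0$ depends only on $a,b$ (in particular $C$ is independent of $\theta$). (ii) If $b=0$ and $a\in\mathbb R\setminus\mathbb Q$ has finite irrationality measure $\mu(a)$, then for every $r>\mu(a)$ and every $\theta\in[-r,1]$, $u\in H_{\mathrm{mix}}^{(k_1+\theta,\,k_2+1-r-\theta)}(\mathbb T^2)$. Moreover, $$\|u-\widehat u(0,0)\|_{H_{\mathrm{mix}}^{(k_1+\theta,\,k_2+1-r-\theta)}(\mathbb T^2)}\le C\,\|f\|_{H_{\mathrm{mix}}^{(k_1,k_2)}(\mathbb T^2)},$$ where $C>0$ depends only on $a,r$ (in particular $C$ is independent of $\theta$).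
   Context: $\mathbb T=\mathbb R/2\pi\mathbb Z$, with variables $(t,x)\in\mathbb T^2$ and dual frequencies $(\tau,\xi)\in\mathbb Z^2$. $\mathcal D'(\mathbb T^2)$ is the space of distributions on $\mathbb T^2$. Fourier coefficients are $\widehat f(\tau,\xi)=\frac1{(2\pi)^2}\int_{\mathbb T^2}f(t,x)e^{-i(t\tau+x\xi)}\,dt\,dx$ (by duality for distributions); the number $\widehat u(0,0)$ is identified with a constant function. $\langle w\rangle=(1+|w|^2)^{1/2}$. For $s_1,s_2\in\mathbb R$, $H_{\mathrm{mix}}^{(s_1,s_2)}(\mathbb T^2)$ is the space of $f\in\mathcal D'(\mathbb T^2)$ with $\|f\|_{H_{\mathrm{mix}}^{(s_1,s_2)}(\mathbb T^2)}^2=\sum_{(\tau,\xi)\in\mathbb Z^2}\langle\tau\rangle^{2s_1}\langle\xi\rangle^{2s_2}|\widehat f(\tau,\xi)|^2<\infty$. The irrationality measure of $a\in\mathbb R\setminus\mathbb Q$ is $\mu(a)=\sup\{\nu>0:\ |a-p/q|<q^{-\nu}\text{ for infinitely many }(p,q)\in\mathbb Z\times\mathbb N\}\in[2,\infty]$. *)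

theory Defs
  imports "HOL-Analysis.Analysis"
begin

text \<open>
  Functions on the torus (the square of the reals modulo \<open>2\<pi>\<close>) are represented by functions on the
  plane that are \<open>2\<pi>\<close>-periodic in each of the two variables \<open>(t, x)\<close>.
\<close>

definition periodic_T2 :: "(real \<times> real \<Rightarrow> complex) \<Rightarrow> bool" where
  "periodic_T2 \<phi> \<longleftrightarrow> (\<forall>t x. \<phi> (t + 2 * pi, x) = \<phi> (t, x) \<and> \<phi> (t, x + 2 * pi) = \<phi> (t, x))"

definition dt :: "(real \<times> real \<Rightarrow> complex) \<Rightarrow> (real \<times> real \<Rightarrow> complex)" where
  "dt \<phi> = (\<lambda>z. frechet_derivative \<phi> (at z) (1, 0))"

definition dx :: "(real \<times> real \<Rightarrow> complex) \<Rightarrow> (real \<times> real \<Rightarrow> complex)" where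
  "dx \<phi> = (\<lambda>z. frechet_derivative \<phi> (at z) (0, 1))"

fun Ck_R2 :: "nat \<Rightarrow> (real \<times> real \<Rightarrow> complex) \<Rightarrow> bool" where
  "Ck_R2 0 \<phi> \<longleftrightarrow> continuous_on UNIV \<phi>"
| "Ck_R2 (Suc k) \<phi> \<longleftrightarrow> \<phi> differentiable_on UNIV \<and> Ck_R2 k (dt \<phi>) \<and> Ck_R2 k (dx \<phi>)"

definition test_functions :: "(real \<times> real \<Rightarrow> complex) set" where
  "test_functions = {\<phi>. periodic_T2 \<phi> \<and> (\<forall>k. Ck_R2 k \<phi>)}"

definition test_tendsto ::
    "(nat \<Rightarrow> real \<times> real \<Rightarrow> complex) \<Rightarrow> (real \<times> real \<Rightarrow> complex) \<Rightarrow> bool" where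
  "test_tendsto \<Phi> \<phi> \<longleftrightarrow>
     (\<forall>j k. uniform_limit UNIV (\<lambda>n. (dt ^^ j) ((dx ^^ k) (\<Phi> n))) ((dt ^^ j) ((dx ^^ k) \<phi>)) sequentially)"

text \<open>
  A distribution is a continuous complex-linear functional on the test functions. The space of test
  functions is metrizable, so continuity is sequential continuity. Only the values on
  \<^const>\<open>test_functions\<close> matter: equality of distributions is always tested there.
\<close>

type_synonym functional = "(real \<times> real \<Rightarrow> complex) \<Rightarrow> complex"

definition distributions :: "functional set" where
  "distributions = {u.
     (\<forall>\<phi>\<in>test_functions. \<forall>\<psi>\<in>test_functions. \<forall>\<alpha> \<beta>.
        u (\<lambda>z. \<alpha> * \<phi> z + \<beta> * \<psi> z) = \<alpha> * u \<phi> + \<beta> * u \<psi>) \<and>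
     (\<forall>\<Phi> \<phi>. (\<forall>n. \<Phi> n \<in> test_functions) \<longrightarrow> \<phi> \<in> test_functions \<longrightarrow> test_tendsto \<Phi> \<phi> \<longrightarrow>
        (\<lambda>n. u (\<Phi> n)) \<longlonglongrightarrow> u \<phi>)}"

definition dist_eq :: "functional \<Rightarrow> functional \<Rightarrow> bool" where
  "dist_eq u v \<longleftrightarrow> (\<forall>\<phi>\<in>test_functions. u \<phi> = v \<phi>)"

definition dist_diff :: "functional \<Rightarrow> functional \<Rightarrow> functional" where
  "dist_diff u v = (\<lambda>\<phi>. u \<phi> - v \<phi>)"

text \<open>The distribution induced by a function, with the pairing normalised by plain Lebesgue measure
  on a fundamental domain.\<close>

definition dist_of_fun :: "(real \<times> real \<Rightarrow> complex) \<Rightarrow> functional" where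
  "dist_of_fun g = (\<lambda>\<phi>. integral (cbox (0, 0) (2 * pi, 2 * pi)) (\<lambda>z. g z * \<phi> z))"

definition dist_dt :: "functional \<Rightarrow> functional" where
  "dist_dt u = (\<lambda>\<phi>. - u (dt \<phi>))"

definition dist_dx :: "functional \<Rightarrow> functional" where
  "dist_dx u = (\<lambda>\<phi>. - u (dx \<phi>))"

definition transport_op :: "complex \<Rightarrow> functional \<Rightarrow> functional" where
  "transport_op c u = (\<lambda>\<phi>. dist_dt u \<phi> - c * dist_dx u \<phi>)"

definition fourier_coeff :: "functional \<Rightarrow> int \<Rightarrow> int \<Rightarrow> complex" where
  "fourier_coeff u \<tau> \<xi> =
     1 / (2 * of_real pi) ^ 2 *
     u (\<lambda>(t, x). exp (- \<i> * of_real (t * of_int \<tau> + x * of_int \<xi>)))"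

definition japanese_bracket :: "real \<Rightarrow> real" where
  "japanese_bracket w = sqrt (1 + \<bar>w\<bar> ^ 2)"

definition Hmix_term :: "real \<Rightarrow> real \<Rightarrow> functional \<Rightarrow> int \<times> int \<Rightarrow> real" where
  "Hmix_term s1 s2 f = (\<lambda>(\<tau>, \<xi>).
     japanese_bracket (of_int \<tau>) powr (2 * s1) * japanese_bracket (of_int \<xi>) powr (2 * s2) *
     (cmod (fourier_coeff f \<tau> \<xi>)) ^ 2)"

definition Hmix :: "real \<Rightarrow> real \<Rightarrow> functional set" where
  "Hmix s1 s2 = {f \<in> distributions. Hmix_term s1 s2 f summable_on UNIV}"

text \<open>Meaningful only on \<^const>\<open>Hmix\<close>; elsewhere the sum defaults to 0.\<close>

definition Hmix_norm :: "real \<Rightarrow> real \<Rightarrow> functional \<Rightarrow> real" where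
  "Hmix_norm s1 s2 f = sqrt (\<Sum>\<^sub>\<infinity>k\<in>UNIV. Hmix_term s1 s2 f k)"

definition irrationality_measure :: "real \<Rightarrow> ereal" where
  "irrationality_measure a = Sup (ereal ` {\<nu>. \<nu> > 0 \<and>
     infinite {(p :: int, q :: nat). q > 0 \<and> \<bar>a - of_int p / of_nat q\<bar> < of_nat q powr (- \<nu>)}})"

end

(* Testing Lu = f against characters gives f^(tau,xi) = i (tau - c xi) u^(tau,xi), so both parts reduce
   to the pointwise bound <tau>^theta <xi>^(m - theta) <= C |tau - c xi| for (tau,xi) <> (0,0), with
   m = 1 or m = 1 - r.  For fixed (tau,xi) the left-hand side is an exponential function of theta, so
   it suffices to treat the two endpoints of the theta-interval, and C is then uniform in theta.
   If b <> 0 the symbol is elliptic.  If b = 0, finiteness of the set of rational approximations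
   with exponent r gives <xi>^(1 - r) <= C |tau - a xi|, and since a <> 0 this also controls the weights
   <tau> <xi>^(-r) and <tau>^(-r) <xi>. *)

theory Submission
  imports Defs
begin

section \<open>Characters of the torus as test functions\<close>

text \<open>It carries the negative sign of the Fourier kernel, so evaluating a distribution at it
  gives the Fourier coefficient up to the factor \<open>(2 * pi) ^ 2\<close>.\<close>

definition torus_character :: "int \<Rightarrow> int \<Rightarrow> real \<times> real \<Rightarrow> complex" where
  "torus_character \<tau> \<xi> = (\<lambda>(t, x). exp (- \<i> * of_real (t * of_int \<tau> + x * of_int \<xi>)))"

lemma torus_character_has_derivative:
  "((\<lambda>z. \<alpha> * torus_character \<tau> \<xi> z) has_derivative
     (\<lambda>h. - \<i> * of_real (fst h * of_int \<tau> + snd h * of_int \<xi>) * (\<alpha> * torus_character \<tau> \<xi> z))) (at z)"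
proof -
  let ?g = "\<lambda>z :: real \<times> real. - \<i> * of_real (fst z * of_int \<tau> + snd z * of_int \<xi>)"
  have "bounded_linear (\<lambda>z :: real \<times> real. fst z * of_int \<tau> + snd z * of_int \<xi>)"
    by (intro bounded_linear_add bounded_linear_mult_const bounded_linear_fst bounded_linear_snd)
  then have "bounded_linear ?g"
    by (intro bounded_linear_const_mult bounded_linear_of_real[THEN bounded_linear_compose])
  then have g: "(?g has_derivative ?g) (at z)"
    by (rule bounded_linear_imp_has_derivative)
  have "(exp has_derivative (*) (exp (?g z))) (at (?g z))"
    using DERIV_exp[of "?g z"] by (simp add: has_field_derivative_def)
  from has_derivative_compose[OF g this]
  have "((\<lambda>z. \<alpha> * exp (?g z)) has_derivative (\<lambda>h. \<alpha> * (exp (?g z) * ?g h))) (at z)"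
    by (rule has_derivative_mult_right)
  then show ?thesis
    by (simp add: torus_character_def case_prod_beta mult_ac)
qed

lemma dt_torus_character:
  "dt (\<lambda>z. \<alpha> * torus_character \<tau> \<xi> z) = (\<lambda>z. (- \<i> * of_int \<tau> * \<alpha>) * torus_character \<tau> \<xi> z)"
  unfolding dt_def
  by (simp add: frechet_derivative_at[OF torus_character_has_derivative, symmetric] mult_ac)

lemma dx_torus_character:
  "dx (\<lambda>z. \<alpha> * torus_character \<tau> \<xi> z) = (\<lambda>z. (- \<i> * of_int \<xi> * \<alpha>) * torus_character \<tau> \<xi> z)"
  unfolding dx_def
  by (simp add: frechet_derivative_at[OF torus_character_has_derivative, symmetric] mult_ac)

text \<open>Both partial derivatives of a multiple of a character are again multiples of the same
  character, so the induction closes once the scalar \<open>\<alpha>\<close> is left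
  arbitrary.\<close>

lemma Ck_R2_torus_character: "Ck_R2 k (\<lambda>z. \<alpha> * torus_character \<tau> \<xi> z)"
proof (induction k arbitrary: \<alpha>)
  case 0
  show ?case
    by (auto intro!: continuous_at_imp_continuous_on
        has_derivative_continuous[OF torus_character_has_derivative])
next
  case (Suc k)
  have "(\<lambda>z. \<alpha> * torus_character \<tau> \<xi> z) differentiable_on UNIV"
    unfolding differentiable_on_def differentiable_def
    using torus_character_has_derivative by blast
  then show ?case
    unfolding Ck_R2.simps dt_torus_character dx_torus_character using Suc.IH by blast
qed

lemma exp_minus_ii_2pi_int: "exp (- (\<i> * (2 * of_real pi * of_int n))) = 1"
  using exp_integer_2pi[of "- of_int n"] by (simp add: mult_ac)

lemma periodic_torus_character: "periodic_T2 (torus_character \<tau> \<xi>)"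
  unfolding periodic_T2_def torus_character_def
  by (simp add: ring_distribs exp_add exp_diff exp_minus_ii_2pi_int[simplified exp_minus] exp_minus mult_ac)

lemma torus_character_test: "torus_character \<tau> \<xi> \<in> test_functions"
  using Ck_R2_torus_character[of _ 1] periodic_torus_character by (simp add: test_functions_def)

section \<open>Fourier coefficients of \<open>Lu\<close> and of \<open>u\<close> minus its
  mean\<close>

lemma fourier_coeff_eq:
  "fourier_coeff u \<tau> \<xi> = 1 / (2 * of_real pi) ^ 2 * u (torus_character \<tau> \<xi>)"
  by (simp add: fourier_coeff_def torus_character_def)

lemma distribution_scale:
  assumes "u \<in> distributions" "\<phi> \<in> test_functions"
  shows "u (\<lambda>z. \<alpha> * \<phi> z) = \<alpha> * u \<phi>"
proof -
  have "u (\<lambda>z. \<alpha> * \<phi> z + 0 * \<phi> z) = \<alpha> * u \<phi> + 0 * u \<phi>"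
    using assms unfolding distributions_def by blast
  then show ?thesis by simp
qed

text \<open>The minus sign in the distributional derivative cancels the one from differentiating the
  character, so \<partial>_t and \<partial>_x act on coefficients as multiplication by i\<tau> and
  i\<xi>. The equation is tested only against characters.\<close>

lemma fourier_coeff_transport_op:
  assumes u: "u \<in> distributions" and eq: "dist_eq (transport_op c u) f"
  shows "fourier_coeff f \<tau> \<xi> = \<i> * (of_int \<tau> - c * of_int \<xi>) * fourier_coeff u \<tau> \<xi>"
proof -
  have dt: "u (dt (torus_character \<tau> \<xi>)) = - \<i> * of_int \<tau> * u (torus_character \<tau> \<xi>)"
    using dt_torus_character[of 1 \<tau> \<xi>] distribution_scale[OF u torus_character_test, of "- \<i> * of_int \<tau>"]
    by simp
  have dx: "u (dx (torus_character \<tau> \<xi>)) = - \<i> * of_int \<xi> * u (torus_character \<tau> \<xi>)"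
    using dx_torus_character[of 1 \<tau> \<xi>] distribution_scale[OF u torus_character_test, of "- \<i> * of_int \<xi>"]
    by simp
  have "f (torus_character \<tau> \<xi>) = transport_op c u (torus_character \<tau> \<xi>)"
    using eq torus_character_test by (simp add: dist_eq_def)
  then show ?thesis
    by (simp add: fourier_coeff_eq transport_op_def dist_dt_def dist_dx_def dt dx field_simps)
qed

lemma integral_exp_period:
  "integral {0..2 * pi} (\<lambda>t. exp (- \<i> * of_real (t * of_int n))) = (if n = 0 then 2 * of_real pi else (0 :: complex))"
proof (cases "n = 0")
  case False
  let ?F = "\<lambda>t :: real. exp (- \<i> * of_real (t * of_int n)) / (- \<i> * of_int n)"
  have "((\<lambda>t. exp (- \<i> * of_real (t * of_int n))) has_integral ?F (2 * pi) - ?F 0) {0..2 * pi}"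
    using False
    by (intro fundamental_theorem_of_calculus)
      (auto intro!: derivative_eq_intros has_vector_derivative_real_field simp: mult_ac)
  then show ?thesis
    using False exp_minus_ii_2pi_int[of n] by (simp add: integral_unique mult_ac)
qed (simp add: scaleR_conv_of_real)

text \<open>Fubini for a continuous integrand reduces this to a product of two one-dimensional
  integrals, each of which vanishes at a nonzero frequency.\<close>

lemma integral_torus_character:
  "integral (cbox (0, 0) (2 * pi, 2 * pi)) (torus_character \<tau> \<xi>)
     = (if \<tau> = 0 \<and> \<xi> = 0 then (2 * of_real pi) ^ 2 else 0)"
proof -
  have "continuous_on (cbox (0, 0) (2 * pi, 2 * pi)) (\<lambda>(t, x). torus_character \<tau> \<xi> (t, x))"
    unfolding torus_character_def case_prod_beta by (intro continuous_intros)
  then have "integral (cbox (0, 0) (2 * pi, 2 * pi)) (\<lambda>(t, x). torus_character \<tau> \<xi> (t, x))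
      = integral {0..2 * pi} (\<lambda>t. integral {0..2 * pi} (\<lambda>x. torus_character \<tau> \<xi> (t, x)))"
    by (subst integral_prod_continuous) auto
  also have "\<dots> = integral {0..2 * pi} (\<lambda>t. exp (- \<i> * of_real (t * of_int \<tau>)) *
      integral {0..2 * pi} (\<lambda>x. exp (- \<i> * of_real (x * of_int \<xi>))))"
    by (subst integral_mult_right[symmetric])
      (simp add: torus_character_def ring_distribs flip: exp_add)
  finally show ?thesis
    using integral_exp_period[of \<tau>] integral_exp_period[of \<xi>]
    by (simp add: power2_eq_square)
qed

text \<open>By orthogonality a constant has no coefficient away from the origin. At the origin the
  area \<open>(2 * pi) ^ 2\<close> of the fundamental domain cancels the normalising factor of
  \<open>fourier_coeff\<close>.\<close>

lemma fourier_coeff_minus_mean: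
  "fourier_coeff (dist_diff u (dist_of_fun (\<lambda>_. fourier_coeff u 0 0))) \<tau> \<xi>
     = (if \<tau> = 0 \<and> \<xi> = 0 then 0 else fourier_coeff u \<tau> \<xi>)"
  using integral_torus_character[of \<tau> \<xi>]
  by (auto simp: fourier_coeff_eq dist_diff_def dist_of_fun_def)

section \<open>Reduction to a pointwise bound on the symbol\<close>

lemma japanese_bracket_ge_1: "1 \<le> japanese_bracket w"
  by (simp add: japanese_bracket_def)

lemma abs_le_japanese_bracket: "\<bar>w\<bar> \<le> japanese_bracket w"
  by (simp add: japanese_bracket_def real_le_rsqrt)

lemma japanese_bracket_le: "japanese_bracket w \<le> 1 + \<bar>w\<bar>"
  unfolding japanese_bracket_def by (rule real_le_lsqrt) (auto simp: power2_eq_square algebra_simps)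

text \<open>Away from the origin the coefficient of \<open>f\<close> is that of \<open>u\<close>
  times a symbol of modulus |\<tau> - c \<xi>|, so squaring \<open>mult\<close> compares the two
  series term by term. The symbol vanishes at the origin: there the mean is subtracted for the norm
  bound, while membership of \<open>u\<close> is unaffected by a single term.\<close>

lemma Hmix_multiplier_estimate:
  assumes u: "u \<in> distributions" and f: "f \<in> Hmix k1 k2"
    and eq: "dist_eq (transport_op c u) f" and "C > 0"
    and mult: "\<And>\<tau> \<xi>. (\<tau>, \<xi>) \<noteq> (0, 0) \<Longrightarrow>
      japanese_bracket (of_int \<tau>) powr s1 * japanese_bracket (of_int \<xi>) powr s2
        \<le> C * cmod (of_int \<tau> - c * of_int \<xi>)"
  shows "u \<in> Hmix (k1 + s1) (k2 + s2)"
    and "Hmix_norm (k1 + s1) (k2 + s2) (dist_diff u (dist_of_fun (\<lambda>_. fourier_coeff u 0 0)))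
           \<le> C * Hmix_norm k1 k2 f"
proof -
  define v where "v = dist_diff u (dist_of_fun (\<lambda>_. fourier_coeff u 0 0))"
  have bound: "Hmix_term (k1 + s1) (k2 + s2) v k \<le> C\<^sup>2 * Hmix_term k1 k2 f k" for k
  proof (cases k)
    case k: (Pair \<tau> \<xi>)
    let ?A = "japanese_bracket (of_int \<tau>)" and ?B = "japanese_bracket (of_int \<xi>)"
    let ?D = "cmod (of_int \<tau> - c * of_int \<xi>)" and ?U = "cmod (fourier_coeff u \<tau> \<xi>)"
    show ?thesis
    proof (cases "\<tau> = 0 \<and> \<xi> = 0")
      case True
      then show ?thesis
        by (simp add: k Hmix_term_def v_def fourier_coeff_minus_mean)
    next
      case False
      \<comment> \<open>Separates the given weight from the gained one. The gained weight appears as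
        a square, matching the squared bound on the multiplier.\<close>
      have sq: "x powr (2 * (k + s)) = x powr (2 * k) * (x powr s)\<^sup>2" for x k s :: real
        by (simp only: distrib_left mult_2[of s] powr_add power2_eq_square)
      have "(?A powr s1 * ?B powr s2)\<^sup>2 \<le> (C * ?D)\<^sup>2"
        using mult[of \<tau> \<xi>] False by (intro power_mono) auto
      then have "(?A powr (2 * k1) * ?B powr (2 * k2) * ?U\<^sup>2) * (?A powr s1 * ?B powr s2)\<^sup>2
          \<le> (?A powr (2 * k1) * ?B powr (2 * k2) * ?U\<^sup>2) * (C * ?D)\<^sup>2"
        by (intro mult_left_mono) auto
      then show ?thesis
        unfolding k Hmix_term_def prod.case sq using False
        by (simp add: v_def fourier_coeff_minus_mean norm_mult
            fourier_coeff_transport_op[OF u eq] power_mult_distrib mult_ac)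
    qed
  qed
  have sf: "Hmix_term k1 k2 f summable_on UNIV"
    using f by (simp add: Hmix_def)
  then have sCf: "(\<lambda>k. C\<^sup>2 * Hmix_term k1 k2 f k) summable_on UNIV"
    by (rule summable_on_cmult_right)
  have nonneg: "0 \<le> Hmix_term p q w k" for p q w k
    by (cases k) (simp add: Hmix_term_def)
  have sv: "Hmix_term (k1 + s1) (k2 + s2) v summable_on UNIV"
    using sCf bound nonneg by (rule summable_on_comparison_test)
  \<comment> \<open>Summability passes from \<open>v\<close> to \<open>u\<close>: their terms agree
    off the origin, and restoring one index does not change summability.\<close>
  have "Hmix_term (k1 + s1) (k2 + s2) v summable_on (UNIV - {(0, 0)})"
    using sv by (rule summable_on_subset_banach) auto
  also have "?this \<longleftrightarrow> Hmix_term (k1 + s1) (k2 + s2) u summable_on (UNIV - {(0, 0)})"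
    by (rule summable_on_cong) (auto simp: Hmix_term_def v_def fourier_coeff_minus_mean split: if_splits)
  finally have "Hmix_term (k1 + s1) (k2 + s2) u summable_on insert (0, 0) (UNIV - {(0, 0)})"
    by (simp only: summable_on_insert_iff)
  then show "u \<in> Hmix (k1 + s1) (k2 + s2)"
    using u by (simp add: Hmix_def insert_UNIV)
  have "(\<Sum>\<^sub>\<infinity>k. Hmix_term (k1 + s1) (k2 + s2) v k) \<le> (\<Sum>\<^sub>\<infinity>k. C\<^sup>2 * Hmix_term k1 k2 f k)"
    using sv sCf bound by (rule infsum_mono)
  also have "\<dots> = C\<^sup>2 * (\<Sum>\<^sub>\<infinity>k. Hmix_term k1 k2 f k)"
    by (rule infsum_cmult_right) (use sf in auto)
  finally have "Hmix_norm (k1 + s1) (k2 + s2) v \<le> sqrt (C\<^sup>2 * (\<Sum>\<^sub>\<infinity>k. Hmix_term k1 k2 f k))"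
    unfolding Hmix_norm_def by (rule real_sqrt_le_mono)
  then show "Hmix_norm (k1 + s1) (k2 + s2) (dist_diff u (dist_of_fun (\<lambda>_. fourier_coeff u 0 0)))
      \<le> C * Hmix_norm k1 k2 f"
    using \<open>C > 0\<close> by (simp add: v_def Hmix_norm_def real_sqrt_mult)
qed

section \<open>Interpolation in \<theta>\<close>

text \<open>The product equals \<open>B powr m * (A / B) powr \<theta>\<close>, which is monotone in
  \<open>\<theta>\<close>: nondecreasing if \<open>B \<le> A\<close>, nonincreasing otherwise. Its
  maximum over the interval is thus attained at an endpoint, and the same \<open>M\<close> serves
  every \<open>\<theta>\<close>.\<close>

lemma powr_mult_powr_le_endpoints:
  fixes A B M l h m \<theta> :: real
  assumes A: "A > 0" and B: "B > 0" and \<theta>: "\<theta> \<in> {l..h}"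
    and low: "A powr l * B powr (m - l) \<le> M" and high: "A powr h * B powr (m - h) \<le> M"
  shows "A powr \<theta> * B powr (m - \<theta>) \<le> M"
proof -
  have eq: "A powr p * B powr (m - p) = B powr m * (A / B) powr p" for p
    using A B by (simp add: powr_diff powr_divide)
  show ?thesis
  proof (cases "B \<le> A")
    case True
    then have "(A / B) powr \<theta> \<le> (A / B) powr h"
      using B \<theta> by (intro powr_mono) auto
    then have "B powr m * (A / B) powr \<theta> \<le> B powr m * (A / B) powr h"
      by (rule mult_left_mono) simp
    then show ?thesis using high by (simp only: eq)
  next
    case False
    then have "(A / B) powr \<theta> \<le> (A / B) powr l"
      using A B \<theta> by (intro powr_mono') auto
    then have "B powr m * (A / B) powr \<theta> \<le> B powr m * (A / B) powr l"
      by (rule mult_left_mono) simp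
    then show ?thesis using low by (simp only: eq)
  qed
qed

section \<open>The elliptic case\<close>

text \<open>Frequencies are integers. This absorbs the summand 1 in the upper bound
  \<open>japanese_bracket w \<le> 1 + \<bar>w\<bar>\<close>.\<close>

lemma one_le_abs_add_abs:
  assumes "(\<tau>, \<xi>) \<noteq> (0, 0 :: int)"
  shows "1 \<le> \<bar>real_of_int \<tau>\<bar> + \<bar>real_of_int \<xi>\<bar>"
  using assms by (cases "\<tau> = 0") auto

text \<open>The imaginary part of the symbol is -b\<xi> and controls \<xi>; the real part \<tau> -
  a\<xi> then controls \<tau>. Together |\<tau>| + |\<xi>| is at most \<open>C / 2 * D\<close>, and
  the remaining factor 2 pays for the 1 in the bracket.\<close>

lemma elliptic_symbol_bound:
  fixes a b :: real
  assumes b: "b \<noteq> 0" and nz: "(\<tau>, \<xi>) \<noteq> (0, 0 :: int)"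
  defines "D \<equiv> cmod (of_int \<tau> - Complex a b * of_int \<xi>)"
    and "C \<equiv> 2 * (1 + (1 + \<bar>a\<bar>) / \<bar>b\<bar>)"
  shows "japanese_bracket (of_int \<tau>) \<le> C * D" and "japanese_bracket (of_int \<xi>) \<le> C * D"
proof -
  let ?t = "real_of_int \<tau>" and ?x = "real_of_int \<xi>"
  have "\<bar>b * ?x\<bar> \<le> D"
    using abs_Im_le_cmod[of "of_int \<tau> - Complex a b * of_int \<xi>"] by (simp add: D_def)
  then have x: "\<bar>?x\<bar> \<le> D / \<bar>b\<bar>"
    using b by (simp add: abs_mult field_simps)
  have "\<bar>?t - a * ?x\<bar> \<le> D"
    using abs_Re_le_cmod[of "of_int \<tau> - Complex a b * of_int \<xi>"] by (simp add: D_def)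
  then have "\<bar>?t\<bar> \<le> D + \<bar>a * ?x\<bar>" by linarith
  also have "\<bar>a * ?x\<bar> \<le> \<bar>a\<bar> * (D / \<bar>b\<bar>)"
    unfolding abs_mult using x by (rule mult_left_mono) simp
  finally have "\<bar>?t\<bar> + \<bar>?x\<bar> \<le> D + \<bar>a\<bar> * (D / \<bar>b\<bar>) + D / \<bar>b\<bar>"
    using x by linarith
  also have "2 * \<dots> = C * D"
    by (simp add: C_def algebra_simps add_divide_distrib)
  finally have "2 * (\<bar>?t\<bar> + \<bar>?x\<bar>) \<le> C * D" by simp
  then have "1 + \<bar>?t\<bar> \<le> C * D" "1 + \<bar>?x\<bar> \<le> C * D"
    using one_le_abs_add_abs[OF nz] by auto
  then show "japanese_bracket ?t \<le> C * D" "japanese_bracket ?x \<le> C * D"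
    using japanese_bracket_le order_trans by blast+
qed

section \<open>Diophantine bounds from the irrationality measure\<close>

text \<open>Rounding \<open>a * q\<close> leaves an error of at most 1/2, hence |a - p/q| < 1/q for
  every \<open>q > 0\<close>; distinct \<open>q\<close> give distinct pairs. The resulting
  \<open>r > 1\<close> makes the exponent \<open>1 - r\<close> negative in the estimates that
  follow.\<close>

lemma irrationality_measure_ge_1: "1 \<le> irrationality_measure a"
proof -
  let ?S = "{(p :: int, q :: nat). q > 0 \<and> \<bar>a - of_int p / of_nat q\<bar> < of_nat q powr - 1}"
  have "(round (a * real q), q) \<in> ?S" if "q > 0" for q :: nat
  proof -
    have "\<bar>of_int (round (a * real q)) - a * real q\<bar> \<le> 1 / 2"
      by (rule of_int_round_abs_le)
    then have "\<bar>a * real q - of_int (round (a * real q))\<bar> < 1"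
      by linarith
    moreover have "a - of_int (round (a * real q)) / real q = (a * real q - of_int (round (a * real q))) / real q"
      using that by (simp add: field_simps)
    ultimately show ?thesis
      using that by (simp add: powr_minus_divide divide_strict_right_mono)
  qed
  then have "(\<lambda>q. (round (a * real q), q)) ` {0<..} \<subseteq> ?S" by auto
  moreover have "infinite ((\<lambda>q :: nat. (round (a * real q), q)) ` {0<..})"
    by (subst finite_image_iff) (auto simp: inj_on_def infinite_Ioi)
  ultimately have "infinite ?S" by (rule infinite_super)
  then have "ereal 1 \<le> irrationality_measure a"
    unfolding irrationality_measure_def by (intro Sup_upper imageI) auto
  then show ?thesis by (simp add: one_ereal_def)
qed

lemma irrationality_measure_less_imp:
  assumes "ereal r > irrationality_measure a"
  shows "r > 1"
proof -
  have "1 < ereal r"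
    using irrationality_measure_ge_1 assms by (rule le_less_trans)
  then show ?thesis by (simp add: one_ereal_def)
qed

text \<open>As \<open>r\<close> lies above the supremum, only finitely many fractions approximate
  \<open>a\<close> with exponent \<open>r\<close>. Irrationality keeps each of their errors
  positive, so a minimum over these exceptions yields a uniform constant.\<close>

lemma diophantine_lower_bound:
  assumes a: "a \<notin> \<rat>" and r: "ereal r > irrationality_measure a"
  obtains \<delta> where "\<delta> > 0"
    and "\<And>p q :: int. q \<noteq> 0 \<Longrightarrow> \<delta> * \<bar>real_of_int q\<bar> powr (1 - r) \<le> \<bar>of_int p - a * of_int q\<bar>"
proof -
  let ?S = "{(p :: int, q :: nat). q > 0 \<and> \<bar>a - of_int p / of_nat q\<bar> < of_nat q powr (- r)}"
  have "r > 0" using irrationality_measure_less_imp[OF r] by simp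
  have "finite ?S"
  proof (rule ccontr)
    assume "infinite ?S"
    then have "ereal r \<le> irrationality_measure a"
      unfolding irrationality_measure_def using \<open>r > 0\<close> by (intro Sup_upper imageI) auto
    with r show False by simp
  qed
  \<comment> \<open>\<open>R\<close> is the approximation error relative to q^(-r): for
    \<open>q > 0\<close>, a pair lies in the exceptional set exactly when \<open>R < 1\<close>. The
    element 1 inserted in the minimum below accounts for all other pairs.\<close>
  define R where "R = (\<lambda>(p :: int, q :: nat). \<bar>a - of_int p / of_nat q\<bar> * of_nat q powr r)"
  define \<delta> where "\<delta> = Min (insert 1 (R ` ?S))"
  have "R k > 0" if kS: "k \<in> ?S" for k
  proof -
    obtain p q where k: "k = (p, q)" "q > 0" using kS by auto
    have "a \<noteq> of_int p / of_nat q" using a by (metis Rats_divide Rats_of_int Rats_of_nat)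
    then show ?thesis using k by (simp add: R_def)
  qed
  then have "\<delta> > 0"
    unfolding \<delta>_def using \<open>finite ?S\<close> by (subst Min_gr_iff) auto
  have ratio: "\<delta> \<le> R (p, q)" if "q > 0" for p q
  proof (cases "(p, q) \<in> ?S")
    case True
    then show ?thesis unfolding \<delta>_def using \<open>finite ?S\<close> by (intro Min_le) auto
  next
    case False
    have "\<delta> \<le> 1" unfolding \<delta>_def using \<open>finite ?S\<close> by (intro Min_le) auto
    also have "1 \<le> R (p, q)"
      using False that by (simp add: R_def powr_minus field_simps)
    finally show ?thesis .
  qed
  have pos: "\<delta> * real q powr (1 - r) \<le> \<bar>of_int p - a * real q\<bar>" if "q > 0" for p and q :: nat
  proof -
    have "\<delta> * real q powr (1 - r) \<le> R (p, q) * real q powr (1 - r)"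
      using ratio[OF that] by (rule mult_right_mono) simp
    also have "\<dots> = \<bar>a - of_int p / real q\<bar> * real q"
      using that by (simp add: R_def powr_diff)
    also have "\<dots> = \<bar>(a - of_int p / real q) * real q\<bar>"
      by (simp add: abs_mult)
    also have "\<dots> = \<bar>of_int p - a * real q\<bar>"
      using that by (simp add: left_diff_distrib abs_minus_commute)
    finally show ?thesis .
  qed
  \<comment> \<open>A negative \<open>q\<close> is handled by changing the sign of both
    \<open>p\<close> and \<open>q\<close>, which preserves the absolute value.\<close>
  have "\<delta> * \<bar>real_of_int q\<bar> powr (1 - r) \<le> \<bar>of_int p - a * of_int q\<bar>" if "q \<noteq> 0" for p q
    using that pos[of "nat q" p] pos[of "nat (- q)" "- p"]
    by (cases "q > 0") (simp_all add: abs_minus_commute)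
  with \<open>\<delta> > 0\<close> show ?thesis by (rule that)
qed

text \<open>For \<xi> \<noteq> 0, replacing |\<xi>| by the larger bracket decreases the left-hand
  side because \<open>1 - r < 0\<close>. For \<xi> = 0 the bracket is 1 and |\<tau>| \<ge> 1; the
  summand 1 in \<open>1 + 1 / \<delta>\<close> serves this case.\<close>

lemma diophantine_symbol_bound:
  assumes a: "a \<notin> \<rat>" and r: "ereal r > irrationality_measure a"
  obtains C where "C > 0"
    and "\<And>\<tau> \<xi> :: int. (\<tau>, \<xi>) \<noteq> (0, 0) \<Longrightarrow>
      japanese_bracket (of_int \<xi>) powr (1 - r) \<le> C * \<bar>of_int \<tau> - a * of_int \<xi>\<bar>"
proof -
  obtain \<delta> where \<delta>: "\<delta> > 0"
    "\<And>p q :: int. q \<noteq> 0 \<Longrightarrow> \<delta> * \<bar>real_of_int q\<bar> powr (1 - r) \<le> \<bar>of_int p - a * of_int q\<bar>"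
    using diophantine_lower_bound[OF a r] by blast
  have "r > 1" using r by (rule irrationality_measure_less_imp)
  have "japanese_bracket (of_int \<xi>) powr (1 - r) \<le> (1 + 1 / \<delta>) * \<bar>of_int \<tau> - a * of_int \<xi>\<bar>"
    if nz: "(\<tau>, \<xi>) \<noteq> (0, 0)" for \<tau> \<xi> :: int
  proof (cases "\<xi> = 0")
    case True
    then have "1 \<le> \<bar>of_int \<tau> :: real\<bar>"
      using nz one_le_abs_add_abs[of \<tau> \<xi>] by simp
    then have "1 * 1 \<le> (1 + 1 / \<delta>) * \<bar>of_int \<tau> :: real\<bar>"
      using \<delta>(1) by (intro mult_mono) auto
    then show ?thesis using True by (simp add: japanese_bracket_def)
  next
    case False
    have "japanese_bracket (of_int \<xi>) powr (1 - r) \<le> \<bar>real_of_int \<xi>\<bar> powr (1 - r)"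
      using False \<open>r > 1\<close> by (intro powr_mono2' abs_le_japanese_bracket) auto
    also have "\<dots> \<le> 1 / \<delta> * \<bar>of_int \<tau> - a * of_int \<xi>\<bar>"
      using \<delta>(2)[OF False, of \<tau>] \<delta>(1) by (simp add: field_simps)
    also have "\<dots> \<le> (1 + 1 / \<delta>) * \<bar>of_int \<tau> - a * of_int \<xi>\<bar>"
      by (rule mult_right_mono) auto
    finally show ?thesis .
  qed
  moreover have "1 + 1 / \<delta> > 0" using \<delta>(1) by (simp add: add_pos_pos)
  ultimately show ?thesis by (rule that[rotated])
qed

text \<open>These are the weights at the endpoints \<theta> = 1 and \<theta> = -r when the exponents
  sum to \<open>1 - r\<close>. Since \<open>a \<noteq> 0\<close>, each of |\<tau>| and |\<xi>| is
  bounded by a multiple of the other plus a multiple of |\<tau> - a\<xi>|.\<close>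

lemma diophantine_weight_bounds:
  assumes a: "a \<notin> \<rat>" and r: "ereal r > irrationality_measure a"
  obtains C where "C > 0"
    and "\<And>\<tau> \<xi> :: int. (\<tau>, \<xi>) \<noteq> (0, 0) \<Longrightarrow>
      japanese_bracket (of_int \<tau>) * japanese_bracket (of_int \<xi>) powr (- r) \<le> C * \<bar>of_int \<tau> - a * of_int \<xi>\<bar>"
    and "\<And>\<tau> \<xi> :: int. (\<tau>, \<xi>) \<noteq> (0, 0) \<Longrightarrow>
      japanese_bracket (of_int \<tau>) powr (- r) * japanese_bracket (of_int \<xi>) \<le> C * \<bar>of_int \<tau> - a * of_int \<xi>\<bar>"
proof -
  obtain C where C: "C > 0" "\<And>\<tau> \<xi> :: int. (\<tau>, \<xi>) \<noteq> (0, 0) \<Longrightarrow>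
      japanese_bracket (of_int \<xi>) powr (1 - r) \<le> C * \<bar>of_int \<tau> - a * of_int \<xi>\<bar>"
    using diophantine_symbol_bound[OF a r] by blast
  have "r > 1" using r by (rule irrationality_measure_less_imp)
  have "a \<noteq> 0" using a by auto
  \<comment> \<open>\<open>K\<close> compares the bracket of \<xi> with that of \<tau> where |\<tau>
    - a\<xi>| < 1. \<open>C'\<close> is the constant once the decaying weight is moved from \<xi> to
    \<tau>; \<open>C1\<close> and \<open>C2\<close> belong to the two endpoint weights.\<close>
  define K where "K = 1 + 2 / \<bar>a\<bar>"
  define C1 where "C1 = 1 + (1 + \<bar>a\<bar>) * C"
  define C' where "C' = 1 + K powr (r - 1) * C"
  define C2 where "C2 = (1 + 1 / \<bar>a\<bar>) * C' + 1 / \<bar>a\<bar>"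
  have "K > 0" "C1 > 0" "C' > 0"
    unfolding K_def C1_def C'_def using C(1) by (auto intro!: add_pos_nonneg)
  have powr1: "X * X powr (- r) = X powr (1 - r)" if "X \<ge> 1" for X :: real
    using that by (simp add: powr_diff powr_minus divide_inverse)
  have powr_le1: "X powr (- r) \<le> 1" "X powr (- r) \<le> X powr (1 - r)" "X powr (1 - r) \<le> 1" if "X \<ge> 1" for X :: real
    using that \<open>r > 1\<close> powr_mono[of "- r" 0 X] powr_mono[of "1 - r" 0 X] powr_mono[of "- r" "1 - r" X] by auto
  have W1: "japanese_bracket (of_int \<tau>) * japanese_bracket (of_int \<xi>) powr (- r) \<le> C1 * \<bar>of_int \<tau> - a * of_int \<xi>\<bar>"
    if nz: "(\<tau>, \<xi>) \<noteq> (0, 0)" for \<tau> \<xi> :: int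
  proof -
    let ?A = "japanese_bracket (of_int \<tau>)" and ?B = "japanese_bracket (of_int \<xi>)"
    let ?D = "\<bar>of_int \<tau> - a * of_int \<xi>\<bar>"
    have B: "?B \<ge> 1" by (rule japanese_bracket_ge_1)
    have "?A \<le> 1 + \<bar>of_int \<tau>\<bar>" by (rule japanese_bracket_le)
    also have "\<dots> \<le> ?D + (1 + \<bar>a * of_int \<xi>\<bar>)" by linarith
    also have "\<bar>a * of_int \<xi>\<bar> \<le> \<bar>a\<bar> * ?B"
      unfolding abs_mult by (intro mult_left_mono abs_le_japanese_bracket) simp
    finally have "?A \<le> ?D + (1 + \<bar>a\<bar>) * ?B"
      using B by (simp add: algebra_simps)
    then have "?A * ?B powr (- r) \<le> (?D + (1 + \<bar>a\<bar>) * ?B) * ?B powr (- r)"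
      by (rule mult_right_mono) simp
    \<comment> \<open>The first summand is harmless because \<open>?B powr (- r) \<le> 1\<close>;
      the second has exactly the weight bounded by \<open>diophantine_symbol_bound\<close>.\<close>
    also have "\<dots> = ?D * ?B powr (- r) + (1 + \<bar>a\<bar>) * ?B powr (1 - r)"
      by (simp add: ring_distribs flip: powr1[OF B])
    also have "\<dots> \<le> ?D * 1 + (1 + \<bar>a\<bar>) * (C * ?D)"
      using powr_le1[OF B] C(2)[OF nz] by (intro add_mono mult_left_mono) auto
    finally show ?thesis by (simp add: C1_def algebra_simps)
  qed
  \<comment> \<open>The Diophantine bound with \<tau> in the role of \<xi>. If
    \<open>?D \<ge> 1\<close> it is immediate, since the left-hand side is at most 1.\<close>
  have sym: "japanese_bracket (of_int \<tau>) powr (1 - r) \<le> C' * \<bar>of_int \<tau> - a * of_int \<xi>\<bar>"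
    if nz: "(\<tau>, \<xi>) \<noteq> (0, 0)" for \<tau> \<xi> :: int
  proof -
    let ?A = "japanese_bracket (of_int \<tau>)" and ?B = "japanese_bracket (of_int \<xi>)"
    let ?D = "\<bar>of_int \<tau> - a * of_int \<xi>\<bar>"
    have A: "?A \<ge> 1" and B: "?B \<ge> 1" by (rule japanese_bracket_ge_1)+
    show ?thesis
    proof (cases "?D \<ge> 1")
      case True
      have "?A powr (1 - r) \<le> 1 * 1" using powr_le1[OF A] by simp
      also have "\<dots> \<le> C' * ?D"
        using True C(1) by (intro mult_mono) (auto simp: C'_def)
      finally show ?thesis .
    next
      case False
      \<comment> \<open>Near the line \<open>\<tau> = a \<xi>\<close> the two brackets are comparable.\<close>
      then have "\<bar>a\<bar> * \<bar>of_int \<xi>\<bar> \<le> 2 * ?A"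
        using abs_le_japanese_bracket[of "of_int \<tau>"] A unfolding abs_mult[symmetric] by linarith
      then have "\<bar>of_int \<xi>\<bar> \<le> 2 / \<bar>a\<bar> * ?A"
        using \<open>a \<noteq> 0\<close> by (simp add: field_simps)
      then have "?B \<le> K * ?A"
        using japanese_bracket_le[of "of_int \<xi>"] A by (simp add: K_def algebra_simps)
      then have "(K * ?A) powr (1 - r) \<le> ?B powr (1 - r)"
        using B \<open>r > 1\<close> by (intro powr_mono2') auto
      \<comment> \<open>The prefactor is chosen to cancel the factor \<open>K powr (1 - r)\<close>
        produced by the comparison.\<close>
      then have "K powr (r - 1) * (K * ?A) powr (1 - r) \<le> K powr (r - 1) * ?B powr (1 - r)"
        by (rule mult_left_mono) simp
      also have "K powr (r - 1) * (K * ?A) powr (1 - r) = ?A powr (1 - r)"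
        using \<open>K > 0\<close> A by (simp add: powr_mult powr_diff)
      also have "K powr (r - 1) * ?B powr (1 - r) \<le> K powr (r - 1) * (C * ?D)"
        using C(2)[OF nz] by (rule mult_left_mono) simp
      also have "\<dots> \<le> C' * ?D"
        by (simp add: C'_def algebra_simps)
      finally show ?thesis .
    qed
  qed
  \<comment> \<open>Mirror image of \<open>W1\<close>: \<xi> is expressed through \<tau> by dividing
    by \<open>a\<close>, and \<open>sym\<close> bounds the resulting power of the \<tau>
    bracket.\<close>
  have W2: "japanese_bracket (of_int \<tau>) powr (- r) * japanese_bracket (of_int \<xi>) \<le> C2 * \<bar>of_int \<tau> - a * of_int \<xi>\<bar>"
    if nz: "(\<tau>, \<xi>) \<noteq> (0, 0)" for \<tau> \<xi> :: int
  proof -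
    let ?A = "japanese_bracket (of_int \<tau>)" and ?B = "japanese_bracket (of_int \<xi>)"
    let ?D = "\<bar>of_int \<tau> - a * of_int \<xi>\<bar>"
    have A: "?A \<ge> 1" by (rule japanese_bracket_ge_1)
    have "\<bar>a\<bar> * \<bar>of_int \<xi>\<bar> \<le> ?A + ?D"
      using abs_le_japanese_bracket[of "of_int \<tau>"] unfolding abs_mult[symmetric] by linarith
    then have "\<bar>of_int \<xi>\<bar> \<le> 1 / \<bar>a\<bar> * (?A + ?D)"
      using \<open>a \<noteq> 0\<close> by (simp add: field_simps)
    then have "?B \<le> (1 + 1 / \<bar>a\<bar>) * ?A + 1 / \<bar>a\<bar> * ?D"
      using japanese_bracket_le[of "of_int \<xi>"] A by (simp add: algebra_simps)
    then have "?A powr (- r) * ?B \<le> ?A powr (- r) * ((1 + 1 / \<bar>a\<bar>) * ?A + 1 / \<bar>a\<bar> * ?D)"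
      by (rule mult_left_mono) simp
    also have "\<dots> = (1 + 1 / \<bar>a\<bar>) * ?A powr (1 - r) + 1 / \<bar>a\<bar> * (?D * ?A powr (- r))"
      by (simp add: algebra_simps flip: powr1[OF A])
    also have "\<dots> \<le> (1 + 1 / \<bar>a\<bar>) * (C' * ?D) + 1 / \<bar>a\<bar> * (?D * 1)"
      using powr_le1[OF A] sym[OF nz] by (intro add_mono mult_left_mono) auto
    finally show ?thesis by (simp add: C2_def algebra_simps)
  qed
  show ?thesis
  proof (rule that[of "max C1 C2"])
    show "max C1 C2 > 0" using \<open>C1 > 0\<close> by simp
  qed (meson W1 W2 abs_ge_zero max.cobounded1 max.cobounded2 mult_right_mono order_trans)+
qed

section \<open>Both regularity statements with a constant uniform in \<theta>\<close>

theorem theorem4p1: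
  fixes a b :: real and c :: complex
  assumes c: "c = Complex a b"
  shows
    "(b \<noteq> 0 \<longrightarrow>
       (\<exists>C>0. \<forall>k1 k2 :: real. \<forall>u\<in>distributions. \<forall>f\<in>Hmix k1 k2.
          dist_eq (transport_op c u) f \<longrightarrow>
          (\<forall>\<theta>\<in>{0..1}.
             u \<in> Hmix (k1 + \<theta>) (k2 + 1 - \<theta>) \<and>
             Hmix_norm (k1 + \<theta>) (k2 + 1 - \<theta>)
               (dist_diff u (dist_of_fun (\<lambda>_. fourier_coeff u 0 0)))
             \<le> C * Hmix_norm k1 k2 f)))
     \<and>
     (b = 0 \<and> a \<notin> \<rat> \<and> irrationality_measure a < \<infinity> \<longrightarrow>
       (\<forall>r::real. ereal r > irrationality_measure a \<longrightarrow>
         (\<exists>C>0. \<forall>k1 k2 :: real. \<forall>u\<in>distributions. \<forall>f\<in>Hmix k1 k2.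
            dist_eq (transport_op c u) f \<longrightarrow>
            (\<forall>\<theta>\<in>{- r..1}.
               u \<in> Hmix (k1 + \<theta>) (k2 + 1 - r - \<theta>) \<and>
               Hmix_norm (k1 + \<theta>) (k2 + 1 - r - \<theta>)
                 (dist_diff u (dist_of_fun (\<lambda>_. fourier_coeff u 0 0)))
               \<le> C * Hmix_norm k1 k2 f))))"
proof (intro conjI impI allI)
  have pos: "japanese_bracket w > 0" for w
    using japanese_bracket_ge_1[of w] by linarith
  {
    assume b: "b \<noteq> 0"
    \<comment> \<open>Fixed before \<open>k1\<close>, \<open>k2\<close>, \<open>u\<close>,
      \<open>f\<close> and \<open>\<theta>\<close> enter, so it depends on \<open>a\<close> and
      \<open>b\<close> alone.\<close>
    define C where "C = 2 * (1 + (1 + \<bar>a\<bar>) / \<bar>b\<bar>)"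
    have "C > 0" by (simp add: C_def add_pos_nonneg)
    \<comment> \<open>With total exponent 1, the endpoints \<theta> = 0 and \<theta> = 1 leave a
      single bracket, that of \<xi> or of \<tau>, which the elliptic bound covers.\<close>
    have "japanese_bracket (of_int \<tau>) powr \<theta> * japanese_bracket (of_int \<xi>) powr (1 - \<theta>)
        \<le> C * cmod (of_int \<tau> - c * of_int \<xi>)"
      if "(\<tau>, \<xi>) \<noteq> (0, 0)" "\<theta> \<in> {0..1}" for \<tau> \<xi> \<theta>
      using elliptic_symbol_bound[OF b that(1), of a] pos
      by (intro powr_mult_powr_le_endpoints[OF pos pos that(2)])
        (simp_all add: C_def c abs_of_pos)
    \<comment> \<open>Reassociating \<open>k2 + 1 - \<theta>\<close> as
      \<open>k2 + (1 - \<theta>)\<close> exhibits the shift \<open>s2\<close> of the multiplier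
      estimate.\<close>
    from Hmix_multiplier_estimate[OF _ _ _ \<open>C > 0\<close> this] \<open>C > 0\<close>
    show "\<exists>C>0. \<forall>k1 k2 :: real. \<forall>u\<in>distributions. \<forall>f\<in>Hmix k1 k2.
          dist_eq (transport_op c u) f \<longrightarrow>
          (\<forall>\<theta>\<in>{0..1}.
             u \<in> Hmix (k1 + \<theta>) (k2 + 1 - \<theta>) \<and>
             Hmix_norm (k1 + \<theta>) (k2 + 1 - \<theta>)
               (dist_diff u (dist_of_fun (\<lambda>_. fourier_coeff u 0 0)))
             \<le> C * Hmix_norm k1 k2 f)"
      unfolding add_diff_eq[symmetric] by blast
  }
  fix r :: real
  assume "b = 0 \<and> a \<notin> \<rat> \<and> irrationality_measure a < \<infinity>"
    and r: "ereal r > irrationality_measure a"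
  then have b: "b = 0" and a: "a \<notin> \<rat>" by auto
  obtain C where C: "C > 0"
    "\<And>\<tau> \<xi> :: int. (\<tau>, \<xi>) \<noteq> (0, 0) \<Longrightarrow>
      japanese_bracket (of_int \<tau>) * japanese_bracket (of_int \<xi>) powr (- r) \<le> C * \<bar>of_int \<tau> - a * of_int \<xi>\<bar>"
    "\<And>\<tau> \<xi> :: int. (\<tau>, \<xi>) \<noteq> (0, 0) \<Longrightarrow>
      japanese_bracket (of_int \<tau>) powr (- r) * japanese_bracket (of_int \<xi>) \<le> C * \<bar>of_int \<tau> - a * of_int \<xi>\<bar>"
    using diophantine_weight_bounds[OF a r] by blast
  have norm_symbol: "cmod (of_int \<tau> - c * of_int \<xi>) = \<bar>of_int \<tau> - a * of_int \<xi>\<bar>" for \<tau> \<xi>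
  proof -
    have "of_int \<tau> - c * of_int \<xi> = complex_of_real (of_int \<tau> - a * of_int \<xi>)"
      using b by (simp add: c complex_eq_iff)
    then show ?thesis by (simp only: norm_of_real)
  qed
  \<comment> \<open>Interpolation with total exponent \<open>1 - r\<close> between
    \<open>- r\<close> and 1; the two Diophantine weights are its endpoint hypotheses.\<close>
  have "japanese_bracket (of_int \<tau>) powr \<theta> * japanese_bracket (of_int \<xi>) powr (1 - r - \<theta>)
      \<le> C * cmod (of_int \<tau> - c * of_int \<xi>)"
    if "(\<tau>, \<xi>) \<noteq> (0, 0)" "\<theta> \<in> {- r..1}" for \<tau> \<xi> \<theta>
    using C(2,3)[OF that(1)] pos
    by (intro powr_mult_powr_le_endpoints[OF pos pos that(2)])
      (simp_all add: norm_symbol less_imp_le)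
  from Hmix_multiplier_estimate[OF _ _ _ \<open>C > 0\<close> this] \<open>C > 0\<close>
  show "\<exists>C>0. \<forall>k1 k2 :: real. \<forall>u\<in>distributions. \<forall>f\<in>Hmix k1 k2.
            dist_eq (transport_op c u) f \<longrightarrow>
            (\<forall>\<theta>\<in>{- r..1}.
               u \<in> Hmix (k1 + \<theta>) (k2 + 1 - r - \<theta>) \<and>
               Hmix_norm (k1 + \<theta>) (k2 + 1 - r - \<theta>)
                 (dist_diff u (dist_of_fun (\<lambda>_. fourier_coeff u 0 0)))
               \<le> C * Hmix_norm k1 k2 f)"
    unfolding add_diff_eq[symmetric] by blast
qed

end
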